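(* Let $\Gamma=G(\mathbb{Z}_n,\mathcal{C})$ be a connected oriented circulant graph with an even number $n$ of vertices. If there is zero transfer between $u$ and $v$ in $\Gamma$, and the eigenvalue $0$ of $\Gamma$ has multiplicity exactly two, then $u-v$ is odd.
   Context: For $\mathcal{C}\subseteq\mathbb{Z}_n\setminus\{0\}$, the circulant graph $G(\mathbb{Z}_n,\mathcal{C})$ has vertex set $\mathbb{Z}_n$ and arc set $\{(a,b): b-a\in\mathcal{C},\ a,b\in\mathbb{Z}_n\}$; it is an oriented circulant graph if $\mathcal{C}\cap\mathcal{C}^{-1}=\emptyset$, where $\mathcal{C}^{-1}=\{-c: c\in\mathcal{C}\}$. Connected means that the underlying undirected graph is connected. Its Hermitian adjacency matrix $H$ has $H_{a,b}=\mathrm{i}$ if $b-a\in\mathcal{C}$, $H_{a,b}=-\mathrm{i}$ if $a-b\in\mathcal{C}$, and $H_{a,b}=0$ otherwise, where $\mathrm{i}=\sqrt{-1}$; the eigenvalues of $\Gamma$ are those of $H$. The transition matrix is $U(t)=\exp(-\mathrm{i}tH)$, $t\in\mathbb{R}$. There is zero transfer between vertices $u$ and $v$ if $U(t)_{u,v}=0$ for all $t\ge 0$ (this condition is symmetric in $u$ and $v$). Since $n$ is even, parity of elements of $\mathbb{Z}_n$ is well defined. *)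

theory Defs
  imports
    "HOL-Analysis.Analysis"
    "Graph_Theory.Pair_Digraph"
    "Graph_Theory.Digraph_Component"
    "Jordan_Normal_Form.Char_Poly"
begin

text \<open>
  The group of integers modulo \<open>n\<close> is represented by the canonical residues
  \<open>{0..<int n}\<close>; a difference \<open>b - a\<close> taken in that group is \<open>(b - a) mod int n\<close>.
\<close>

definition circulant_graph :: "nat \<Rightarrow> int set \<Rightarrow> int pair_pre_digraph" where
  "circulant_graph n C =
     \<lparr> pverts = {0..<int n},
       parcs = {(a, b). a \<in> {0..<int n} \<and> b \<in> {0..<int n} \<and> (b - a) mod int n \<in> C} \<rparr>"

definition neg_residues :: "nat \<Rightarrow> int set \<Rightarrow> int set" where
  "neg_residues n C = (\<lambda>c. (- c) mod int n) ` C"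

definition oriented_connection_set :: "nat \<Rightarrow> int set \<Rightarrow> bool" where
  "oriented_connection_set n C \<longleftrightarrow> C \<subseteq> {0..<int n} - {0} \<and> C \<inter> neg_residues n C = {}"

text \<open>The vertex \<open>a \<in> {0..<int n}\<close> is the row and column index \<open>nat a\<close>.\<close>

definition hermitian_adj :: "nat \<Rightarrow> int set \<Rightarrow> complex mat" where
  "hermitian_adj n C = mat n n (\<lambda>(a, b).
     if (int b - int a) mod int n \<in> C then \<i>
     else if (int a - int b) mod int n \<in> C then - \<i>
     else 0)"

text \<open>The exponential series of a square matrix, taken entrywise.\<close>

definition mat_exp :: "complex mat \<Rightarrow> complex mat" where
  "mat_exp A = mat (dim_row A) (dim_row A) (\<lambda>(i, j). \<Sum>k. (A ^\<^sub>m k) $$ (i, j) / fact k)"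

lemma mat_exp_summable:
  fixes A :: "complex mat"
  assumes A: "A \<in> carrier_mat n n" and i: "i < n" and j: "j < n"
  shows "summable (\<lambda>k. (A ^\<^sub>m k) $$ (i, j) / fact k)"
proof -
  define M where "M = (\<Sum>a<n. \<Sum>b<n. norm (A $$ (a, b)))"
  have M: "norm (A $$ (a, b)) \<le> M" if "a < n" "b < n" for a b
  proof -
    have "norm (A $$ (a, b)) \<le> (\<Sum>b<n. norm (A $$ (a, b)))"
      using that by (intro member_le_sum) auto
    also have "\<dots> \<le> M"
      unfolding M_def
      using that by (intro member_le_sum[where f = "\<lambda>a. \<Sum>b<n. norm (A $$ (a, b))"])
        (auto intro: sum_nonneg)
    finally show ?thesis .
  qed
  have M0: "0 \<le> M" unfolding M_def by (intro sum_nonneg) auto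
  have pow: "A ^\<^sub>m k \<in> carrier_mat n n" for k using A by simp
  have bound: "norm ((A ^\<^sub>m k) $$ (i, j)) \<le> (real n * M) ^ k" if "j < n" for k j
    using that
  proof (induction k arbitrary: j)
    case 0
    then show ?case using A i by simp
  next
    case (Suc k)
    have "(A ^\<^sub>m Suc k) $$ (i, j) = (\<Sum>l<n. (A ^\<^sub>m k) $$ (i, l) * A $$ (l, j))"
      using pow[of k] A i Suc.prems by (simp add: scalar_prod_def atLeast0LessThan)
    also have "norm \<dots> \<le> (\<Sum>l<n. (real n * M) ^ k * M)"
      using Suc.IH M Suc.prems M0
      by (intro sum_norm_le) (auto simp: norm_mult intro!: mult_mono)
    also have "\<dots> = (real n * M) ^ Suc k" by simp
    finally show ?case .
  qed
  have "summable (\<lambda>k. inverse (fact k) * (real n * M) ^ k)"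
    by (rule summable_exp)
  then show ?thesis
    by (rule summable_comparison_test'[where N = 0])
      (use bound[OF j] in \<open>simp add: norm_divide divide_simps\<close>)
qed

definition transition_matrix :: "nat \<Rightarrow> int set \<Rightarrow> real \<Rightarrow> complex mat" where
  "transition_matrix n C t = mat_exp ((- \<i> * complex_of_real t) \<cdot>\<^sub>m hermitian_adj n C)"

definition zero_transfer :: "nat \<Rightarrow> int set \<Rightarrow> int \<Rightarrow> int \<Rightarrow> bool" where
  "zero_transfer n C u v \<longleftrightarrow> (\<forall>t\<ge>0. transition_matrix n C t $$ (nat u, nat v) = 0)"

end

theory Submission
  imports "HOL-Complex_Analysis.Cauchy_Integral_Formula" Defs
begin

text \<open>
  The characters of the cyclic group diagonalise \<open>H\<close>, and since the arc weights form an odd function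
  on the group, the eigenvalues of the two real characters, with indices \<open>0\<close> and \<open>n/2\<close>, vanish.
  Zero transfer makes the \<open>(u, v)\<close> entry of every polynomial in \<open>H\<close> vanish, in particular that of
  the projection onto the kernel. When the kernel has dimension two it is spanned by the two real
  characters, so that this entry is \<open>(1 + (-1)\<^sup>u\<^sup>-\<^sup>v) / n\<close>.
\<close>

section \<open>Characters of the cyclic group of order \<open>n\<close>\<close>

definition dft_char :: "nat \<Rightarrow> int \<Rightarrow> complex" where
  "dft_char n x = cis (2 * pi * of_int x / of_nat n)"

lemma dft_char_0 [simp]: "dft_char n 0 = 1"
  by (simp add: dft_char_def)

lemma dft_char_add: "dft_char n (x + y) = dft_char n x * dft_char n y"
  by (simp add: dft_char_def cis_mult add_divide_distrib ring_distribs)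

lemma dft_char_mult_nat: "dft_char n (x * int k) = dft_char n x ^ k"
proof -
  have "2 * pi * of_int (x * int k) / of_nat n = of_nat k * (2 * pi * of_int x / of_nat n)"
    by simp
  then show ?thesis
    by (simp only: dft_char_def Complex.DeMoivre)
qed

lemma dft_char_eq_1_iff:
  assumes "n > 0"
  shows "dft_char n x = 1 \<longleftrightarrow> int n dvd x"
proof
  assume "dft_char n x = 1"
  then obtain k :: int where "2 * pi * of_int x / of_nat n = of_int (2 * k) * pi"
    unfolding dft_char_def cis_conv_exp exp_eq_1 by auto
  then have "real_of_int x = real_of_int (k * int n)"
    using assms by (simp add: field_simps)
  then show "int n dvd x"
    by (metis dvd_triv_right of_int_eq_iff)
next
  assume "int n dvd x"
  then obtain k where "x = int n * k" ..
  then have "2 * pi * of_int x / of_nat n = 2 * pi * of_int k"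
    using assms by simp
  then show "dft_char n x = 1"
    by (simp add: dft_char_def)
qed

lemma dft_char_cong:
  assumes "n > 0" "int n dvd x - y"
  shows "dft_char n x = dft_char n y"
  using dft_char_add[of n "x - y" y] dft_char_eq_1_iff[OF assms(1)] assms(2) by simp

lemma dft_char_mult_mod:
  assumes "n > 0"
  shows "dft_char n (j * (x mod int n)) = dft_char n (j * x)"
  by (rule dft_char_cong[OF assms])
    (metis dvd_mult dvd_minus_mod dvd_diff_commute right_diff_distrib)

text \<open>The summands form a geometric progression whose ratio \<open>dft_char n x\<close> is an
  n-th root of unity, equal to 1 exactly when \<open>n\<close> divides \<open>x\<close>.\<close>

lemma sum_dft_char:
  assumes "n > 0"
  shows "(\<Sum>k<n. dft_char n (x * int k)) = (if int n dvd x then of_nat n else 0)"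
proof (cases "int n dvd x")
  case True
  then have "dft_char n x = 1"
    using assms by (simp add: dft_char_eq_1_iff)
  then show ?thesis
    using True by (simp add: dft_char_mult_nat)
next
  case False
  then have "dft_char n x \<noteq> 1"
    using assms by (simp add: dft_char_eq_1_iff)
  moreover have "dft_char n x ^ n = 1"
    using assms by (simp add: dft_char_mult_nat[symmetric] dft_char_eq_1_iff)
  ultimately show ?thesis
    using False by (simp add: dft_char_mult_nat geometric_sum)
qed

section \<open>Sums of periodic functions, arc weights and the eigenvalues\<close>

lemma sum_periodic_shift:
  fixes g :: "int \<Rightarrow> 'a :: comm_monoid_add"
  assumes "n > 0" and g: "\<And>x. g (x mod int n) = g x"
  shows "(\<Sum>d<n. g (int d - a)) = (\<Sum>d<n. g (int d))"
  \<comment> \<open>Translations by \<open>a\<close> and \<open>- a\<close>, reduced modulo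
    \<open>n\<close>, are mutually inverse permutations of the residues, and \<open>g\<close> does
    not see the reduction.\<close>
  by (rule sum.reindex_bij_witness[where i = "\<lambda>d. nat ((int d + a) mod int n)"
        and j = "\<lambda>d. nat ((int d - a) mod int n)"])
    (use assms in \<open>auto simp: mod_simps nat_less_iff\<close>)

lemma sum_periodic_uminus:
  fixes g :: "int \<Rightarrow> 'a :: comm_monoid_add"
  assumes "n > 0" and g: "\<And>x. g (x mod int n) = g x"
  shows "(\<Sum>d<n. g (- int d)) = (\<Sum>d<n. g (int d))"
  by (rule sum.reindex_bij_witness[where i = "\<lambda>d. nat ((- int d) mod int n)"
        and j = "\<lambda>d. nat ((- int d) mod int n)"])
    (use assms in \<open>auto simp: mod_simps nat_less_iff\<close>)

text \<open>The entry of H as a function of the difference of its indices. It is defined on all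
  integers, so that differences need not be reduced first.\<close>

definition arc_weight :: "nat \<Rightarrow> int set \<Rightarrow> int \<Rightarrow> complex" where
  "arc_weight n C d = (if d mod int n \<in> C then \<i> else if (- d) mod int n \<in> C then - \<i> else 0)"

text \<open>The Fourier transform of the arc weights: row 0 of H applied to the character of index
  \<open>j\<close>.\<close>

definition circulant_eigenvalue :: "nat \<Rightarrow> int set \<Rightarrow> int \<Rightarrow> complex" where
  "circulant_eigenvalue n C j = (\<Sum>d<n. arc_weight n C (int d) * dft_char n (j * int d))"

lemma arc_weight_mod: "arc_weight n C (x mod int n) = arc_weight n C x"
  by (simp add: arc_weight_def mod_simps)

text \<open>Orientedness excludes that \<open>x\<close> and \<open>- x\<close> both lie in
  \<open>C\<close> modulo \<open>n\<close>; in that case both would receive the weight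
  \<open>\<i>\<close>.\<close>

lemma arc_weight_uminus:
  assumes "oriented_connection_set n C"
  shows "arc_weight n C (- x) = - arc_weight n C x"
proof -
  have "\<not> (x mod int n \<in> C \<and> (- x) mod int n \<in> C)"
  proof
    assume *: "x mod int n \<in> C \<and> (- x) mod int n \<in> C"
    then have "(- (x mod int n)) mod int n \<in> neg_residues n C"
      unfolding neg_residues_def by blast
    then show False
      using * assms by (auto simp: oriented_connection_set_def mod_simps)
  qed
  then show ?thesis
    by (auto simp: arc_weight_def)
qed

text \<open>The divisibility condition makes the character of index \<open>j\<close> real, hence
  even. Against the odd arc weights it gives an odd summand, so negating the summation variable
  shows the sum to equal its own negative.\<close>

lemma circulant_eigenvalue_eq_0:
  assumes n: "n > 0" and C: "oriented_connection_set n C" and j: "int n dvd 2 * j"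
  shows "circulant_eigenvalue n C j = 0"
proof -
  define g where "g = (\<lambda>x. arc_weight n C x * dft_char n (j * x))"
  have "g (x mod int n) = g x" for x
    by (simp add: g_def arc_weight_mod dft_char_mult_mod[OF n])
  then have "(\<Sum>d<n. g (- int d)) = (\<Sum>d<n. g (int d))"
    using n by (intro sum_periodic_uminus)
  moreover have "g (- x) = - g x" for x
  proof -
    have "int n dvd j * (- x) - j * x"
      using j by (simp flip: mult_2 mult.assoc)
    then have "dft_char n (j * (- x)) = dft_char n (j * x)"
      by (intro dft_char_cong[OF n])
    then show ?thesis
      by (simp add: g_def arc_weight_uminus[OF C])
  qed
  ultimately have "(\<Sum>d<n. g (int d)) = - (\<Sum>d<n. g (int d))"
    by (simp add: sum_negf)
  then show ?thesis
    by (simp add: circulant_eigenvalue_def g_def)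
qed

section \<open>Diagonalisation of H by the Fourier matrix\<close>

lemma hermitian_adj_carrier [simp]: "hermitian_adj n C \<in> carrier_mat n n"
  by (simp add: hermitian_adj_def)

lemma hermitian_adj_index:
  "a < n \<Longrightarrow> b < n \<Longrightarrow> hermitian_adj n C $$ (a, b) = arc_weight n C (int b - int a)"
  by (simp add: hermitian_adj_def arc_weight_def)

text \<open>The columns are the characters, which are eigenvectors of H.\<close>

definition dft_mat :: "nat \<Rightarrow> complex mat" where
  "dft_mat n = mat n n (\<lambda>(a, j). dft_char n (int a * int j))"

text \<open>Conjugate transpose of \<open>dft_mat n\<close>, scaled by \<open>1 / n\<close>; that it
  is an inverse is the orthogonality of characters.\<close>

definition dft_mat_inv :: "nat \<Rightarrow> complex mat" where
  "dft_mat_inv n = mat n n (\<lambda>(j, b). dft_char n (- int b * int j) / of_nat n)"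

lemma dft_mat_carrier [simp]:
  "dft_mat n \<in> carrier_mat n n" "dft_mat_inv n \<in> carrier_mat n n"
  by (simp_all add: dft_mat_def dft_mat_inv_def)

lemma dft_mat_mult_inv:
  assumes n: "n > 0"
  shows "dft_mat n * dft_mat_inv n = 1\<^sub>m n"
proof (rule eq_matI)
  fix a b assume "a < dim_row (1\<^sub>m n :: complex mat)" "b < dim_col (1\<^sub>m n :: complex mat)"
  then have ab: "a < n" "b < n" by auto
  have "(dft_mat n * dft_mat_inv n) $$ (a, b)
      = (\<Sum>k<n. dft_char n (int a * int k) * (dft_char n (- int b * int k) / of_nat n))"
    using ab by (simp add: dft_mat_def dft_mat_inv_def scalar_prod_def atLeast0LessThan)
  also have "\<dots> = (\<Sum>k<n. dft_char n ((int a - int b) * int k)) / of_nat n"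
    by (simp add: sum_divide_distrib dft_char_add[symmetric] algebra_simps)
  also have "\<dots> = 1\<^sub>m n $$ (a, b)"
    using n ab mod_eq_dvd_iff[of "int a" "int n" "int b"] by (simp add: sum_dft_char)
  finally show "(dft_mat n * dft_mat_inv n) $$ (a, b) = 1\<^sub>m n $$ (a, b)" .
qed (simp_all add: dft_mat_def dft_mat_inv_def)

lemma hermitian_adj_mult_dft_mat:
  assumes n: "n > 0"
  shows "hermitian_adj n C * dft_mat n
    = dft_mat n * mat_diag n (\<lambda>j. circulant_eigenvalue n C (int j))"
proof (rule eq_matI)
  let ?R = "dft_mat n * mat_diag n (\<lambda>j. circulant_eigenvalue n C (int j))"
  have R: "?R = mat n n (\<lambda>(i, j). dft_mat n $$ (i, j) * circulant_eigenvalue n C (int j))"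
    by (rule mat_diag_mult_right) simp
  fix a j assume "a < dim_row ?R" "j < dim_col ?R"
  then have aj: "a < n" "j < n" by (auto simp: R)
  define g where "g = (\<lambda>x. arc_weight n C x * dft_char n (int j * x))"
  have g_mod: "g (x mod int n) = g x" for x
    by (simp add: g_def arc_weight_mod dft_char_mult_mod[OF n])
  have "(hermitian_adj n C * dft_mat n) $$ (a, j)
      = (\<Sum>b<n. arc_weight n C (int b - int a) * dft_char n (int b * int j))"
    using aj hermitian_adj_carrier[of n C]
    by (simp add: scalar_prod_def atLeast0LessThan hermitian_adj_index dft_mat_def
        del: hermitian_adj_carrier)
  also have "\<dots> = dft_char n (int a * int j) * (\<Sum>b<n. g (int b - int a))"
    unfolding sum_distrib_left g_def
  proof (rule sum.cong[OF refl])
    fix b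
    \<comment> \<open>Splitting \<open>b\<close> as \<open>a + (b - a)\<close> pulls the value of
      the character at \<open>a\<close> out of the sum; what remains depends on \<open>b - a\<close>
      only and is periodic, so the shift by \<open>a\<close> disappears.\<close>
    have "int b * int j = int a * int j + int j * (int b - int a)"
      by (simp add: algebra_simps)
    then show "arc_weight n C (int b - int a) * dft_char n (int b * int j) = dft_char n (int a * int j)
        * (arc_weight n C (int b - int a) * dft_char n (int j * (int b - int a)))"
      by (simp add: dft_char_add)
  qed
  also have "(\<Sum>b<n. g (int b - int a)) = circulant_eigenvalue n C (int j)"
    unfolding sum_periodic_shift[where g = g, OF n g_mod]
    by (simp add: g_def circulant_eigenvalue_def)
  finally show "(hermitian_adj n C * dft_mat n) $$ (a, j) = ?R $$ (a, j)"
    using aj by (simp add: R) (simp add: dft_mat_def)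
qed (simp_all add: hermitian_adj_def dft_mat_def mat_diag_def)

lemma hermitian_adj_similar:
  assumes n: "n > 0"
  shows "similar_mat_wit (hermitian_adj n C) (mat_diag n (\<lambda>j. circulant_eigenvalue n C (int j)))
    (dft_mat n) (dft_mat_inv n)"
proof (rule similar_mat_witI)
  let ?H = "hermitian_adj n C"
  show "dft_mat_inv n * dft_mat n = 1\<^sub>m n"
    \<comment> \<open>For square matrices a one-sided inverse is two-sided.\<close>
    by (rule mat_mult_left_right_inverse[OF _ _ dft_mat_mult_inv[OF n]]) simp_all
  have "?H = ?H * (dft_mat n * dft_mat_inv n)"
    using dft_mat_mult_inv[OF n] right_mult_one_mat[OF hermitian_adj_carrier, of n C] by simp
  also have "\<dots> = ?H * dft_mat n * dft_mat_inv n"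
    by (rule assoc_mult_mat[OF hermitian_adj_carrier dft_mat_carrier, symmetric])
  finally show "?H = dft_mat n * mat_diag n (\<lambda>j. circulant_eigenvalue n C (int j)) * dft_mat_inv n"
    using hermitian_adj_mult_dft_mat[OF n] by simp
qed (use dft_mat_mult_inv[OF n] in simp_all)

lemma mat_diag_pow: "mat_diag n f ^\<^sub>m k = mat_diag n (\<lambda>i. f i ^ k :: 'a :: comm_semiring_1)"
proof (induction k)
  case 0
  then show ?case by (simp add: mat_diag_def)
next
  case (Suc k)
  then show ?case by (simp add: mult.commute)
qed

text \<open>Powers of H act on the diagonal factor alone, and the characters from row
  \<open>a\<close> and column \<open>b\<close> combine into one character of
  \<open>a - b\<close>.\<close>

lemma hermitian_adj_pow_index:
  assumes n: "n > 0" and ab: "a < n" "b < n"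
  shows "(hermitian_adj n C ^\<^sub>m k) $$ (a, b)
    = (\<Sum>j<n. circulant_eigenvalue n C (int j) ^ k * dft_char n ((int a - int b) * int j)) / of_nat n"
proof -
  let ?e = "\<lambda>j. circulant_eigenvalue n C (int j)"
  have "hermitian_adj n C ^\<^sub>m k = dft_mat n * mat_diag n (\<lambda>j. ?e j ^ k) * dft_mat_inv n"
    using similar_mat_wit_pow_id[OF hermitian_adj_similar[OF n]] by (simp add: mat_diag_pow)
  also have "dft_mat n * mat_diag n (\<lambda>j. ?e j ^ k)
      = mat n n (\<lambda>(i, j). dft_mat n $$ (i, j) * ?e j ^ k)"
    by (rule mat_diag_mult_right) simp
  also have "(\<dots> * dft_mat_inv n) $$ (a, b)
      = (\<Sum>j<n. dft_char n (int a * int j) * ?e j ^ k * (dft_char n (- int b * int j) / of_nat n))"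
    using ab by (simp add: dft_mat_def dft_mat_inv_def scalar_prod_def atLeast0LessThan)
  also have "\<dots> = (\<Sum>j<n. ?e j ^ k * dft_char n ((int a - int b) * int j)) / of_nat n"
  proof -
    have "dft_char n ((int a - int b) * int j)
        = dft_char n (int a * int j) * dft_char n (- int b * int j)" for j
      by (simp add: dft_char_add[symmetric] algebra_simps)
    then show ?thesis
      by (simp add: sum_divide_distrib mult_ac)
  qed
  finally show ?thesis .
qed

section \<open>Algebraic multiplicity of the eigenvalue 0\<close>

lemma order_0_char_poly_mat_diag:
  fixes f :: "nat \<Rightarrow> 'a :: field"
  shows "Polynomial.order 0 (char_poly (mat_diag n f)) = card {j. j < n \<and> f j = 0}"
proof -
  have "upper_triangular (mat_diag n f)"
    by (auto simp: mat_diag_def)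
  then have "char_poly (mat_diag n f) = (\<Prod>a\<leftarrow>diag_mat (mat_diag n f). [:- a, 1:])"
    using char_poly_upper_triangular[of "mat_diag n f" n] by simp
  also have "diag_mat (mat_diag n f) = map f [0..<n]"
    by (auto simp: diag_mat_def mat_diag_def)
  \<comment> \<open>The order at 0 is additive over the linear factors, and such a factor
    contributes 1 exactly when its diagonal entry is 0.\<close>
  finally have "Polynomial.order 0 (char_poly (mat_diag n f))
      = sum_list (map (Polynomial.order 0) (map (\<lambda>a. [:- a, 1:]) (map f [0..<n])))"
    by (simp only:) (rule order_prod_list, auto)
  also have "\<dots> = (\<Sum>j<n. if f j = 0 then 1 else 0)"
    by (simp add: o_def order_linear' sum_list_distinct_conv_sum_set atLeast0LessThan)
  also have "\<dots> = card {j. j < n \<and> f j = 0}"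
    by (simp add: sum.If_cases Int_def)
  finally show ?thesis .
qed

lemma order_0_char_poly_hermitian_adj:
  assumes "n > 0"
  shows "Polynomial.order 0 (char_poly (hermitian_adj n C))
    = card {j. j < n \<and> circulant_eigenvalue n C (int j) = 0}"
proof -
  have "similar_mat (hermitian_adj n C) (mat_diag n (\<lambda>j. circulant_eigenvalue n C (int j)))"
    unfolding similar_mat_def using hermitian_adj_similar[OF assms] by blast
  then show ?thesis
    by (simp add: char_poly_similar order_0_char_poly_mat_diag)
qed

section \<open>From zero transfer to vanishing entries of the powers of H\<close>

lemma smult_pow_mat:
  fixes A :: "'a :: comm_semiring_1 mat"
  assumes A: "A \<in> carrier_mat n n"
  shows "(c \<cdot>\<^sub>m A) ^\<^sub>m k = c ^ k \<cdot>\<^sub>m A ^\<^sub>m k"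
proof (induction k)
  case 0
  then show ?case using A by (intro eq_matI) auto
next
  case (Suc k)
  have "A ^\<^sub>m k \<in> carrier_mat n n" using A by simp
  then have "c ^ k \<cdot>\<^sub>m A ^\<^sub>m k * (c \<cdot>\<^sub>m A) = c ^ Suc k \<cdot>\<^sub>m (A ^\<^sub>m k * A)"
    using A by (intro eq_matI) (auto simp: mult_ac)
  then show ?case by (simp add: Suc)
qed

text \<open>A nonzero coefficient would make 0 an isolated zero of the entire function
  \<open>f\<close>, but \<open>f\<close> vanishes on the whole nonnegative half-line.\<close>

lemma powser_eq_0_imp_coeffs_eq_0:
  fixes a :: "nat \<Rightarrow> complex"
  assumes sm: "\<And>z. summable (\<lambda>k. a k * z ^ k)"
    and zero: "\<And>t :: real. t \<ge> 0 \<Longrightarrow> (\<Sum>k. a k * of_real t ^ k) = 0"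
  shows "a k = 0"
proof (rule ccontr)
  assume ak: "a k \<noteq> 0"
  \<comment> \<open>The constant term is treated apart, by evaluation at 0: the theorem on isolated
    zeros requires \<open>f 0 = 0\<close> and a nonzero coefficient of positive index.\<close>
  have a0: "a 0 = 0"
    using zero[of 0] powser_zero[of a] by simp
  define f where "f z = (\<Sum>k. a k * z ^ k)" for z
  have "(\<lambda>k. a k * (z - 0) ^ k) sums f z" for z
    using sm[of z] unfolding f_def by (simp add: summable_sums)
  moreover have "f 0 = 0"
    using a0 by (simp add: f_def)
  moreover have "k > 0"
    using ak a0 by (cases k) auto
  ultimately obtain s where "0 < s" and s: "\<And>z. z \<in> cball 0 s - {0} \<Longrightarrow> f z \<noteq> 0"
    using powser_0_nonzero[of 1 0 a f k] ak by auto
  have "f (of_real s) \<noteq> 0"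
    using \<open>0 < s\<close> by (intro s) auto
  moreover have "f (of_real s) = 0"
    using zero[of s] \<open>0 < s\<close> by (simp add: f_def)
  ultimately show False by contradiction
qed

text \<open>The entry of U(t) is a power series in \<open>t\<close> whose k-th coefficient is the
  entry of the k-th power of H, up to the nonzero factor
  \<open>(- \<i>) ^ k / fact k\<close>.\<close>

lemma zero_transfer_imp_pow_index_eq_0:
  assumes uv: "u \<in> {0..<int n}" "v \<in> {0..<int n}" and zt: "zero_transfer n C u v"
  shows "(hermitian_adj n C ^\<^sub>m k) $$ (nat u, nat v) = 0"
proof -
  let ?H = "hermitian_adj n C"
  have nat_uv: "nat u < n" "nat v < n"
    using uv by auto
  define a where "a k = (- \<i>) ^ k * (?H ^\<^sub>m k) $$ (nat u, nat v) / fact k" for k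
  \<comment> \<open>Stated for complex \<open>z\<close>, since summability is needed on the whole
    plane and not only at real times.\<close>
  have series_term: "(((- \<i> * z) \<cdot>\<^sub>m ?H) ^\<^sub>m k) $$ (nat u, nat v) / fact k = a k * z ^ k" for z k
  proof -
    have "?H ^\<^sub>m k \<in> carrier_mat n n" by simp
    from carrier_matD[OF this]
    have "(((- \<i> * z) \<cdot>\<^sub>m ?H) ^\<^sub>m k) $$ (nat u, nat v)
        = (- \<i> * z) ^ k * (?H ^\<^sub>m k) $$ (nat u, nat v)"
      using nat_uv by (simp add: smult_pow_mat[OF hermitian_adj_carrier])
    then show ?thesis
      by (simp only: a_def power_mult_distrib times_divide_eq_right mult_ac)
  qed
  have "a k = 0"
  proof (rule powser_eq_0_imp_coeffs_eq_0)
    fix z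
    show "summable (\<lambda>k. a k * z ^ k)"
      using mat_exp_summable[of "(- \<i> * z) \<cdot>\<^sub>m ?H" n, OF _ nat_uv] unfolding series_term by simp
  next
    fix t :: real assume "t \<ge> 0"
    then have "transition_matrix n C t $$ (nat u, nat v) = 0"
      using zt by (simp add: zero_transfer_def)
    moreover have "dim_row ?H = n"
      by (simp add: hermitian_adj_def)
    ultimately show "(\<Sum>k. a k * of_real t ^ k) = 0"
      using nat_uv unfolding transition_matrix_def mat_exp_def by (simp flip: series_term)
  qed
  then show ?thesis
    by (simp add: a_def)
qed

section \<open>Isolating the kernel by a polynomial in H\<close>

lemma sum_poly_eq_0:
  fixes e w :: "'i \<Rightarrow> 'a :: comm_ring_1"
  assumes "\<And>k. (\<Sum>j\<in>J. e j ^ k * w j) = 0"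
  shows "(\<Sum>j\<in>J. poly p (e j) * w j) = 0"
proof -
  have "(\<Sum>j\<in>J. poly p (e j) * w j) = (\<Sum>k\<le>degree p. coeff p k * (\<Sum>j\<in>J. e j ^ k * w j))"
    unfolding poly_altdef sum_distrib_left sum_distrib_right
    by (subst sum.swap) (simp add: mult_ac)
  then show ?thesis
    using assms by simp
qed

theorem corollary4p1:
  fixes n :: nat and C :: "int set" and u v :: int
  assumes "n > 0" and "even n"
    and "oriented_connection_set n C"
    and "Digraph_Component.connected (with_proj (circulant_graph n C))"
    and "u \<in> {0..<int n}" and "v \<in> {0..<int n}"
    and "zero_transfer n C u v"
    and "Polynomial.order 0 (char_poly (hermitian_adj n C)) = 2"
  shows "odd (u - v)"
proof
  assume even: "even (u - v)"
  define e where "e j = circulant_eigenvalue n C (int j)" for j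
  define w where "w j = dft_char n ((u - v) * int j)" for j
  define Z where "Z = {j. j < n \<and> e j = 0}"
  obtain m where m: "n = 2 * m" using \<open>even n\<close> by blast
  \<comment> \<open>\<open>0\<close> and \<open>m\<close> are the indices of the two real
    characters, distinct because \<open>n > 0\<close>; multiplicity two leaves room for no other
    index.\<close>
  have Z: "Z = {0, m}"
  proof -
    have "e 0 = 0" "e m = 0"
      using assms(1,3) m unfolding e_def by (auto intro!: circulant_eigenvalue_eq_0)
    then have "{0, m} \<subseteq> Z"
      using \<open>n > 0\<close> m by (auto simp: Z_def)
    moreover have "card Z = 2"
      using assms(8) order_0_char_poly_hermitian_adj[OF \<open>n > 0\<close>] by (simp add: Z_def e_def)
    moreover have "card {0, m} = 2"
      using \<open>n > 0\<close> m by simp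
    ultimately show ?thesis
      by (metis card_subset_eq card.infinite zero_neq_numeral)
  qed
  \<comment> \<open>Up to the factor \<open>1 / n\<close>, these sums are the (u, v) entries of the
    powers of H.\<close>
  have moments: "(\<Sum>j<n. e j ^ k * w j) = 0" for k
  proof -
    have "(\<Sum>j<n. e j ^ k * w j) / of_nat n = (hermitian_adj n C ^\<^sub>m k) $$ (nat u, nat v)"
      using hermitian_adj_pow_index[OF \<open>n > 0\<close>, of "nat u" "nat v" C k] assms(5,6)
      by (auto simp: e_def w_def nat_less_iff)
    also have "\<dots> = 0"
      by (rule zero_transfer_imp_pow_index_eq_0) (use assms in auto)
    finally show ?thesis
      using \<open>n > 0\<close> by simp
  qed
  \<comment> \<open>The roots of \<open>p\<close> are exactly the nonzero eigenvalues, so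
    \<open>p\<close> evaluated at H is \<open>poly p 0\<close> times the projection onto the kernel.
    As \<open>poly p 0\<close> is nonzero, no normalisation is required.\<close>
  define p where "p = (\<Prod>x\<in>e ` ({..<n} - Z). [:- x, 1:])"
  have p0: "poly p 0 \<noteq> 0"
    by (auto simp: p_def poly_prod Z_def)
  have "poly p (e j) = 0" if "j \<in> {..<n} - Z" for j
    using that by (auto simp: p_def poly_prod)
  then have "(\<Sum>j<n. poly p (e j) * w j) = (\<Sum>j\<in>Z. poly p (e j) * w j)"
    by (intro sum.mono_neutral_right) (auto simp: Z_def)
  also have "\<dots> = (\<Sum>j\<in>Z. poly p 0 * w j)"
    by (rule sum.cong) (auto simp: Z_def)
  also have "\<dots> = poly p 0 * (w 0 + w m)"
    using \<open>n > 0\<close> m by (simp add: Z ring_distribs)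
  finally have "w 0 + w m = 0"
    using sum_poly_eq_0[of e w "{..<n}" p] moments p0 by simp
  \<comment> \<open>The assumed evenness enters here: \<open>n = 2 * m\<close> divides
    \<open>(u - v) * m\<close>. The two terms then add up to 2 instead of cancelling.\<close>
  moreover have "w m = 1"
    using even \<open>n > 0\<close> m by (auto simp: w_def dft_char_eq_1_iff)
  moreover have "w 0 = 1"
    by (simp add: w_def)
  ultimately show False by simp
qed

end
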